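(* The set $I_{XTD} = \{e : \mathrm{XTD}(\mathcal L_e) < \infty\}$ is $\Sigma^0_3$-complete.
   Context: $W_0,W_1,\ldots$ is an acceptable numbering of all r.e. subsets of $\mathbb N$; $L^e_j = \{x : \langle j,x\rangle \in W_e\}$ and $\mathcal L_e = \{L^e_j : j\in\mathbb N\}$. For a family $\mathcal L$ of subsets of $\mathbb N$ and any $L\subseteq\mathbb N$, a set $S\subseteq\mathbb N$ is a specifying set for $L$ w.r.t. $\mathcal L$ iff there is at most one $L'\in\mathcal L$ with $L\cap S = L'\cap S$. The extended teaching dimension $\mathrm{XTD}(\mathcal L)$ is $\inf\{d : \text{every } L\subseteq\mathbb N \text{ has a specifying set w.r.t. } \mathcal L \text{ of at most } d \text{ elements}\}$ (with $\inf\emptyset=\infty$). $\Sigma^0_n$-complete means definable by a $\Sigma^0_n$ formula and every $\Sigma^0_n$ set many-one reduces to it via a recursive function. *)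

theory Defs
  imports Main "HOL-Library.Nat_Bijection" "HOL-Library.Extended_Nat"
begin

section \<open>Recursive functions and r.e. sets\<close>

text \<open>
  \<open>recursive_fn n f\<close>: the function \<open>f\<close>, applied to argument lists of length \<open>n\<close>, is a total
  recursive function. This is the classical inductive definition of the (general) recursive
  functions: minimisation is restricted to functions that have a zero for all parameters, so every
  function generated is total and partial functions need not be modelled. The values of \<open>f\<close> on
  lists whose length is not \<open>n\<close> are irrelevant, which is what rule \<open>cong\<close> says.
\<close>

inductive recursive_fn :: "nat \<Rightarrow> (nat list \<Rightarrow> nat) \<Rightarrow> bool" where
  zero: "recursive_fn n (\<lambda>xs. 0)"
| succ: "recursive_fn 1 (\<lambda>xs. Suc (hd xs))"
| proj: "i < n \<Longrightarrow> recursive_fn n (\<lambda>xs. xs ! i)"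
| comp: "recursive_fn (length fs) g \<Longrightarrow> \<forall>f \<in> set fs. recursive_fn n f \<Longrightarrow>
    recursive_fn n (\<lambda>xs. g (map (\<lambda>f. f xs) fs))"
| prim_rec: "recursive_fn n f \<Longrightarrow> recursive_fn (Suc (Suc n)) g \<Longrightarrow>
    recursive_fn (Suc n) (\<lambda>xs. rec_nat (f (tl xs)) (\<lambda>k r. g (k # r # tl xs)) (hd xs))"
| minim: "recursive_fn (Suc n) f \<Longrightarrow> \<forall>xs. length xs = n \<longrightarrow> (\<exists>y. f (y # xs) = 0) \<Longrightarrow>
    recursive_fn n (\<lambda>xs. LEAST y. f (y # xs) = 0)"
| cong: "recursive_fn n f \<Longrightarrow> \<forall>xs. length xs = n \<longrightarrow> f xs = g xs \<Longrightarrow> recursive_fn n g"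

definition recursive :: "(nat \<Rightarrow> nat) \<Rightarrow> bool" where
  "recursive f \<longleftrightarrow> recursive_fn 1 (\<lambda>xs. f (hd xs))"

definition recursive_rel :: "nat \<Rightarrow> (nat list \<Rightarrow> bool) \<Rightarrow> bool" where
  "recursive_rel n R \<longleftrightarrow> recursive_fn n (\<lambda>xs. if R xs then 1 else 0)"

definition re_set :: "nat set \<Rightarrow> bool" where
  "re_set A \<longleftrightarrow> A = {} \<or> (\<exists>f. recursive f \<and> A = range f)"

text \<open>
  The pairing function is \<^const>\<open>prod_encode\<close>, Cantor's recursive bijection.
  An acceptable numbering is a uniformly r.e. numbering of all r.e. sets to which every uniformly
  r.e. numbering can be translated by a recursive function (equivalently, one that is
  intertranslatable with the standard numbering by domains of partial recursive functions).
\<close>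

definition uniformly_re :: "(nat \<Rightarrow> nat set) \<Rightarrow> bool" where
  "uniformly_re V \<longleftrightarrow> re_set {prod_encode (e, x) | e x. x \<in> V e}"

definition acceptable_numbering :: "(nat \<Rightarrow> nat set) \<Rightarrow> bool" where
  "acceptable_numbering W \<longleftrightarrow>
     range W = {A. re_set A} \<and> uniformly_re W \<and>
     (\<forall>V. uniformly_re V \<longrightarrow> (\<exists>f. recursive f \<and> (\<forall>e. V e = W (f e))))"

section \<open>The arithmetical hierarchy\<close>

text \<open>
  \<open>sigma_prefix n R xs\<close> is \<open>\<exists>y\<^sub>1. \<forall>y\<^sub>2. \<exists>y\<^sub>3. \<dots> R (xs @ [y\<^sub>1, \<dots>, y\<^sub>n])\<close>, with \<open>n\<close> alternating
  quantifiers; \<open>pi_prefix\<close> is the dual, starting with a universal quantifier.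
\<close>

fun sigma_prefix :: "nat \<Rightarrow> (nat list \<Rightarrow> bool) \<Rightarrow> nat list \<Rightarrow> bool"
  and pi_prefix :: "nat \<Rightarrow> (nat list \<Rightarrow> bool) \<Rightarrow> nat list \<Rightarrow> bool" where
  "sigma_prefix 0 R xs = R xs"
| "sigma_prefix (Suc n) R xs = (\<exists>y. pi_prefix n R (xs @ [y]))"
| "pi_prefix 0 R xs = R xs"
| "pi_prefix (Suc n) R xs = (\<forall>y. sigma_prefix n R (xs @ [y]))"

definition sigma_set :: "nat \<Rightarrow> nat set \<Rightarrow> bool" where
  "sigma_set n A \<longleftrightarrow> (\<exists>R. recursive_rel (Suc n) R \<and> A = {x. sigma_prefix n R [x]})"

definition many_one_reducible :: "nat set \<Rightarrow> nat set \<Rightarrow> bool" where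
  "many_one_reducible A B \<longleftrightarrow> (\<exists>f. recursive f \<and> (\<forall>x. x \<in> A \<longleftrightarrow> f x \<in> B))"

definition sigma_complete :: "nat \<Rightarrow> nat set \<Rightarrow> bool" where
  "sigma_complete n A \<longleftrightarrow> sigma_set n A \<and> (\<forall>B. sigma_set n B \<longrightarrow> many_one_reducible B A)"

section \<open>The extended teaching dimension\<close>

definition specifying_set :: "nat set set \<Rightarrow> nat set \<Rightarrow> nat set \<Rightarrow> bool" where
  "specifying_set \<L> L S \<longleftrightarrow> (\<exists>\<^sub>\<le>\<^sub>1 L'. L' \<in> \<L> \<and> L \<inter> S = L' \<inter> S)"

text \<open>Note that \<^term>\<open>Inf {} = (\<infinity> :: enat)\<close>.\<close>

definition XTD :: "nat set set \<Rightarrow> enat" where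
  "XTD \<L> = Inf {enat d | d. \<forall>L. \<exists>S. finite S \<and> card S \<le> d \<and> specifying_set \<L> L S}"

definition lang :: "(nat \<Rightarrow> nat set) \<Rightarrow> nat \<Rightarrow> nat \<Rightarrow> nat set" where
  "lang W e j = {x. prod_encode (j, x) \<in> W e}"

definition lang_family :: "(nat \<Rightarrow> nat set) \<Rightarrow> nat \<Rightarrow> nat set set" where
  "lang_family W e = range (lang W e)"

definition I_XTD :: "(nat \<Rightarrow> nat set) \<Rightarrow> nat set" where
  "I_XTD W = {e. XTD (lang_family W e) < \<infinity>}"

end

(*
  A finite specifying set for L depends only on finitely many bits, so an accumulation point (in
  Cantor space) of an infinite family has no finite specifying set; hence the extended teaching
  dimension is finite iff the family is. A family (L_j) is finite iff some n satisfies
  "L_i restricted to n included in L_j implies L_i included in L_j" for all i, j, which is a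
  Sigma_3 condition for uniformly r.e. families. For hardness, if B is the set of x such that
  R(x,a,b,c) holds for some a, all b and some c, let L_a be the set of all y with y < a or, for
  some a' \<le> a, for all b \<le> y, R(x,a',b,c) for some c. These are initial segments of the natural
  numbers increasing with a; they are eventually equal to the whole set if x is in B, and finite
  but of unbounded size otherwise.
*)
theory Submission
  imports Defs
begin

section \<open>Closure properties of the recursive functions\<close>

lemma recursive_fn_cong:
  "recursive_fn n f \<Longrightarrow> (\<And>xs. length xs = n \<Longrightarrow> f xs = g xs) \<Longrightarrow> recursive_fn n g"
  using recursive_fn.cong by blast

lemma recursive_rel_cong:
  "recursive_rel n P \<Longrightarrow> (\<And>xs. length xs = n \<Longrightarrow> P xs = Q xs) \<Longrightarrow> recursive_rel n Q"
  unfolding recursive_rel_def by (erule recursive_fn_cong) simp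

text \<open>\<open>comp\<close> takes a fixed list of functions, so the argument list is rebuilt
  from its projections. This lets a computed value serve as the recursion argument of
  \<open>prim_rec\<close>.\<close>

lemma recursive_fn_comp_Cons:
  assumes "recursive_fn (Suc n) g" and "recursive_fn n h"
  shows "recursive_fn n (\<lambda>xs. g (h xs # xs))"
proof -
  have "recursive_fn n (\<lambda>xs. g (map (\<lambda>f. f xs) (h # map (\<lambda>i xs. xs ! i) [0..<n])))"
    by (rule recursive_fn.comp) (use assms in \<open>auto intro: recursive_fn.proj\<close>)
  then show ?thesis
    by (rule recursive_fn_cong) (simp add: comp_def, metis map_nth)
qed

lemma recursive_fn_comp1:
  "recursive_fn 1 g \<Longrightarrow> recursive_fn n f \<Longrightarrow> recursive_fn n (\<lambda>xs. g [f xs])"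
  using recursive_fn.comp[of "[f]" g n] by simp

lemma recursive_rel_comp2:
  "recursive_rel 2 R \<Longrightarrow> recursive_fn n f \<Longrightarrow> recursive_fn n g
    \<Longrightarrow> recursive_rel n (\<lambda>xs. R [f xs, g xs])"
  unfolding recursive_rel_def
  using recursive_fn.comp[of "[f, g]" "\<lambda>xs. if R xs then 1 else 0" n]
  by (simp add: numeral_2_eq_2)

lemma recursive_rel_comp4:
  "recursive_rel 4 R \<Longrightarrow> recursive_fn n f \<Longrightarrow> recursive_fn n g \<Longrightarrow> recursive_fn n h
    \<Longrightarrow> recursive_fn n k \<Longrightarrow> recursive_rel n (\<lambda>xs. R [f xs, g xs, h xs, k xs])"
  unfolding recursive_rel_def
  using recursive_fn.comp[of "[f, g, h, k]" "\<lambda>xs. if R xs then 1 else 0" n]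
  by (simp add: numeral_eq_Suc)

lemma recursive_fn_recursive: "recursive f \<Longrightarrow> recursive_fn n g \<Longrightarrow> recursive_fn n (\<lambda>xs. f (g xs))"
  unfolding recursive_def by (drule recursive_fn_comp1) simp_all

text \<open>Each enclosing recursion or bounded quantifier conses values onto the argument list, so
  variables reappear as entries of iterated tails; these forms close the goals that the later rules
  leave.\<close>

lemma recursive_fn_projections:
  shows "i < n \<Longrightarrow> recursive_fn n (\<lambda>xs. xs ! i)"
    and "Suc i < n \<Longrightarrow> recursive_fn n (\<lambda>xs. tl xs ! i)"
    and "Suc (Suc i) < n \<Longrightarrow> recursive_fn n (\<lambda>xs. tl (tl xs) ! i)"
    and "Suc (Suc (Suc i)) < n \<Longrightarrow> recursive_fn n (\<lambda>xs. tl (tl (tl xs)) ! i)"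
    and "0 < n \<Longrightarrow> recursive_fn n hd"
    and "Suc 0 < n \<Longrightarrow> recursive_fn n (\<lambda>xs. hd (tl xs))"
    and "Suc (Suc 0) < n \<Longrightarrow> recursive_fn n (\<lambda>xs. hd (tl (tl xs)))"
proof -
  have [simp]: "xs \<noteq> [] \<Longrightarrow> hd xs = xs ! 0" for xs :: "nat list"
    by (rule hd_conv_nth)
  have [simp]: "tl xs = [] \<longleftrightarrow> length xs \<le> 1" for xs :: "nat list"
    by (cases xs) auto
  show "i < n \<Longrightarrow> recursive_fn n (\<lambda>xs. xs ! i)"
    by (rule recursive_fn.proj)
  show "Suc i < n \<Longrightarrow> recursive_fn n (\<lambda>xs. tl xs ! i)"
    by (rule recursive_fn_cong[OF recursive_fn.proj[of "Suc i"]]) (auto simp: nth_tl)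
  show "Suc (Suc i) < n \<Longrightarrow> recursive_fn n (\<lambda>xs. tl (tl xs) ! i)"
    by (rule recursive_fn_cong[OF recursive_fn.proj[of "Suc (Suc i)"]]) (auto simp: nth_tl)
  show "Suc (Suc (Suc i)) < n \<Longrightarrow> recursive_fn n (\<lambda>xs. tl (tl (tl xs)) ! i)"
    by (rule recursive_fn_cong[OF recursive_fn.proj[of "Suc (Suc (Suc i))"]])
      (auto simp: nth_tl)
  show "0 < n \<Longrightarrow> recursive_fn n hd"
    by (rule recursive_fn_cong[OF recursive_fn.proj[of 0]]) auto
  show "Suc 0 < n \<Longrightarrow> recursive_fn n (\<lambda>xs. hd (tl xs))"
    by (rule recursive_fn_cong[OF recursive_fn.proj[of "Suc 0"]]) (auto simp: nth_tl)
  show "Suc (Suc 0) < n \<Longrightarrow> recursive_fn n (\<lambda>xs. hd (tl (tl xs)))"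
    by (rule recursive_fn_cong[OF recursive_fn.proj[of "Suc (Suc 0)"]])
      (auto simp: nth_tl hd_conv_nth)
qed

lemma recursive_fn_tl:
  assumes "recursive_fn n f"
  shows "recursive_fn (Suc n) (\<lambda>xs. f (tl xs))"
proof -
  have "recursive_fn (Suc n) (\<lambda>xs. f (map (\<lambda>f. f xs) (map (\<lambda>i xs. tl xs ! i) [0..<n])))"
    by (rule recursive_fn.comp) (use assms in \<open>auto intro: recursive_fn_projections\<close>)
  then show ?thesis
    by (rule recursive_fn_cong) (simp add: comp_def, metis map_nth length_tl diff_Suc_1)
qed

text \<open>Lets a relation on counter and parameters be used inside a recursion step, whose second
  argument is the accumulated value.\<close>

lemma recursive_fn_drop_second:
  assumes "recursive_fn (Suc n) f"
  shows "recursive_fn (Suc (Suc n)) (\<lambda>xs. f (hd xs # tl (tl xs)))"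
proof -
  have "recursive_fn (Suc (Suc n))
      (\<lambda>xs. f (map (\<lambda>f. f xs) (hd # map (\<lambda>i xs. tl (tl xs) ! i) [0..<n])))"
    by (rule recursive_fn.comp) (use assms in \<open>auto intro: recursive_fn_projections\<close>)
  moreover have "map (\<lambda>i. tl (tl xs) ! i) [0..<n] = tl (tl xs)" if "length xs = Suc (Suc n)"
    for xs :: "nat list"
    using map_nth[of "tl (tl xs)"] that by simp
  ultimately show ?thesis
    by (elim recursive_fn_cong) (simp add: comp_def)
qed

lemma recursive_fn_rec_nat:
  assumes "recursive_fn n h" and "recursive_fn n f"
    and "recursive_fn (Suc (Suc n)) (\<lambda>ys. g (hd ys) (hd (tl ys)) (tl (tl ys)))"
  shows "recursive_fn n (\<lambda>xs. rec_nat (f xs) (\<lambda>k r. g k r xs) (h xs))"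
  using recursive_fn_comp_Cons[OF recursive_fn.prim_rec[OF assms(2,3)] assms(1)] by simp

section \<open>Arithmetic operations\<close>

lemma recursive_fn_Suc: "recursive_fn n f \<Longrightarrow> recursive_fn n (\<lambda>xs. Suc (f xs))"
  using recursive_fn_comp1[OF recursive_fn.succ] by simp

lemma recursive_fn_const: "recursive_fn n (\<lambda>xs. k)"
  by (induction k) (auto intro: recursive_fn.zero recursive_fn_Suc)

lemma recursive_fn_add:
  assumes "recursive_fn n f" and "recursive_fn n g"
  shows "recursive_fn n (\<lambda>xs. f xs + g xs)"
proof -
  have "rec_nat a (\<lambda>k r. Suc r) b = a + b" for a b :: nat
    by (induction b) auto
  moreover have "recursive_fn n (\<lambda>xs. rec_nat (f xs) (\<lambda>k r. Suc r) (g xs))"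
    by (intro recursive_fn_rec_nat recursive_fn_Suc recursive_fn_projections assms) auto
  ultimately show ?thesis
    by simp
qed

lemma recursive_fn_pred:
  assumes "recursive_fn n f"
  shows "recursive_fn n (\<lambda>xs. f xs - Suc 0)"
proof -
  have "rec_nat 0 (\<lambda>k r. k) b = b - 1" for b :: nat
    by (induction b) auto
  moreover have "recursive_fn n (\<lambda>xs. rec_nat 0 (\<lambda>k r. k) (f xs))"
    by (intro recursive_fn_rec_nat recursive_fn.zero recursive_fn_projections assms) auto
  ultimately show ?thesis
    by simp
qed

lemma recursive_fn_diff:
  assumes "recursive_fn n f" and "recursive_fn n g"
  shows "recursive_fn n (\<lambda>xs. f xs - g xs)"
proof -
  have "rec_nat a (\<lambda>k r. r - Suc 0) b = a - b" for a b :: nat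
    by (induction b) auto
  moreover have "recursive_fn n (\<lambda>xs. rec_nat (f xs) (\<lambda>k r. r - Suc 0) (g xs))"
    by (intro recursive_fn_rec_nat recursive_fn_pred recursive_fn_projections assms) auto
  ultimately show ?thesis
    by simp
qed

section \<open>Definition by cases, decidable relations, bounded quantifiers and
  minimisation\<close>

lemma recursive_fn_if:
  assumes "recursive_rel n P" and "recursive_fn n f" and "recursive_fn n g"
  shows "recursive_fn n (\<lambda>xs. if P xs then f xs else g xs)"
proof -
  \<comment> \<open>The truth value of \<open>P\<close> is the number of recursion steps: none
    leaves \<open>g xs\<close>, one replaces it by \<open>f xs\<close>.\<close>
  have "recursive_fn n (\<lambda>xs. rec_nat (g xs) (\<lambda>k r. f xs) (if P xs then 1 else 0))"
    using assms unfolding recursive_rel_def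
    by (intro recursive_fn_rec_nat recursive_fn_tl) auto
  then show ?thesis
    by (rule recursive_fn_cong) simp
qed

lemma recursive_rel_eq_0:
  assumes "recursive_fn n f"
  shows "recursive_rel n (\<lambda>xs. f xs = 0)"
proof -
  have "recursive_fn n (\<lambda>xs. 1 - f xs)"
    by (intro recursive_fn_diff recursive_fn_const assms)
  then show ?thesis
    unfolding recursive_rel_def by (rule recursive_fn_cong) simp
qed

lemma recursive_rel_le:
  assumes "recursive_fn n f" and "recursive_fn n g"
  shows "recursive_rel n (\<lambda>xs. f xs \<le> g xs)"
  using recursive_rel_eq_0[OF recursive_fn_diff[OF assms]] by simp

lemma recursive_rel_less:
  assumes "recursive_fn n f" and "recursive_fn n g"
  shows "recursive_rel n (\<lambda>xs. f xs < g xs)"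
  using recursive_rel_le[OF recursive_fn_Suc] assms by (simp add: Suc_le_eq)

lemma recursive_rel_if:
  assumes "recursive_rel n P" and "recursive_rel n Q" and "recursive_rel n R"
  shows "recursive_rel n (\<lambda>xs. if P xs then Q xs else R xs)"
proof -
  have "recursive_fn n
    (\<lambda>xs. if P xs then if Q xs then 1 else 0 else if R xs then 1 else 0)"
    using assms(2,3) unfolding recursive_rel_def[of n Q] recursive_rel_def[of n R]
    by (intro recursive_fn_if[OF assms(1)])
  then show ?thesis
    unfolding recursive_rel_def by (rule recursive_fn_cong) simp
qed

lemma recursive_rel_const: "recursive_rel n (\<lambda>xs. b)"
  unfolding recursive_rel_def by (rule recursive_fn_const)

lemma recursive_rel_not:
  assumes "recursive_rel n P"
  shows "recursive_rel n (\<lambda>xs. \<not> P xs)"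
  using recursive_rel_if[OF assms recursive_rel_const[of n False] recursive_rel_const[of n True]]
  by (rule recursive_rel_cong) simp

lemma recursive_rel_conj:
  assumes "recursive_rel n P" and "recursive_rel n Q"
  shows "recursive_rel n (\<lambda>xs. P xs \<and> Q xs)"
  using recursive_rel_if[OF assms recursive_rel_const[of n False]]
  by (rule recursive_rel_cong) simp

lemma recursive_rel_disj:
  assumes "recursive_rel n P" and "recursive_rel n Q"
  shows "recursive_rel n (\<lambda>xs. P xs \<or> Q xs)"
  using recursive_rel_if[OF assms(1) recursive_rel_const[of n True] assms(2)]
  by (rule recursive_rel_cong) simp

lemma recursive_rel_imp:
  assumes "recursive_rel n P" and "recursive_rel n Q"
  shows "recursive_rel n (\<lambda>xs. P xs \<longrightarrow> Q xs)"
  using recursive_rel_disj[OF recursive_rel_not[OF assms(1)] assms(2)]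
  by (rule recursive_rel_cong) simp

lemma recursive_rel_eq:
  assumes "recursive_fn n f" and "recursive_fn n g"
  shows "recursive_rel n (\<lambda>xs. f xs = g xs)"
  using recursive_rel_conj[OF recursive_rel_le[OF assms] recursive_rel_le[OF assms(2,1)]]
  by (rule recursive_rel_cong) auto

lemma recursive_rel_bex:
  assumes "recursive_fn n h" and "recursive_rel (Suc n) (\<lambda>ys. P (hd ys) (tl ys))"
  shows "recursive_rel n (\<lambda>xs. \<exists>k<h xs. P k xs)"
proof -
  have "recursive_rel (Suc (Suc n)) (\<lambda>ys. P (hd ys) (tl (tl ys)))"
    using recursive_fn_drop_second[OF assms(2)[unfolded recursive_rel_def]]
    unfolding recursive_rel_def by simp
  \<comment> \<open>A flag, raised at each witness and otherwise kept, is accumulated over all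
    \<open>k < h xs\<close>.\<close>
  then have "recursive_fn n (\<lambda>xs. rec_nat 0 (\<lambda>k r. if P k xs then 1 else r) (h xs))"
    by (intro recursive_fn_rec_nat recursive_fn_if recursive_fn_const recursive_fn_projections
        assms(1)) auto
  moreover have "rec_nat 0 (\<lambda>k r. if P k xs then 1 else r) m
      = (if \<exists>k<m. P k xs then 1 else 0 :: nat)" for xs m
    by (induction m) (auto simp: less_Suc_eq)
  ultimately show ?thesis
    unfolding recursive_rel_def by (elim recursive_fn_cong) simp
qed

lemma recursive_rel_ball:
  assumes "recursive_fn n h" and "recursive_rel (Suc n) (\<lambda>ys. P (hd ys) (tl ys))"
  shows "recursive_rel n (\<lambda>xs. \<forall>k<h xs. P k xs)"
  using recursive_rel_not[OF recursive_rel_bex[OF assms(1) recursive_rel_not[OF assms(2)]]]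
  by simp

lemma recursive_fn_Least:
  assumes "recursive_rel (Suc n) (\<lambda>ys. P (hd ys) (tl ys))" and "\<And>xs. length xs = n \<Longrightarrow> \<exists>k. P k xs"
  shows "recursive_fn n (\<lambda>xs. LEAST k. P k xs)"
proof -
  \<comment> \<open>Minimisation seeks a zero, so truth of \<open>P\<close> has to be coded by
    0.\<close>
  let ?f = "\<lambda>ys. if \<not> P (hd ys) (tl ys) then 1 else 0 :: nat"
  have "recursive_fn n (\<lambda>xs. LEAST k. ?f (k # xs) = 0)"
  proof (rule recursive_fn.minim)
    show "recursive_fn (Suc n) ?f"
      using recursive_rel_not[OF assms(1)] unfolding recursive_rel_def .
  qed (use assms(2) in auto)
  then show ?thesis
    by (rule recursive_fn_cong) (simp cong: if_cong)
qed

section \<open>Cantor pairing and its inverses\<close>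

lemma recursive_fn_prod_encode:
  assumes "recursive_fn n f" and "recursive_fn n g"
  shows "recursive_fn n (\<lambda>xs. prod_encode (f xs, g xs))"
proof -
  have triangle: "rec_nat 0 (\<lambda>k r. r + Suc k) m = triangle m" for m
    by (induction m) auto
  have "recursive_fn n (\<lambda>xs. rec_nat 0 (\<lambda>k r. r + Suc k) (f xs + g xs) + f xs)"
    by (intro recursive_fn_add recursive_fn_rec_nat recursive_fn_Suc recursive_fn_const
        recursive_fn_projections assms) auto
  then show ?thesis
    unfolding triangle by (simp add: prod_encode_def)
qed

text \<open>The first component is found by search; the other one is bounded by the code itself, so
  each candidate can be tested recursively.\<close>

lemma recursive_fn_fst_prod_decode:
  assumes "recursive_fn n f"
  shows "recursive_fn n (\<lambda>xs. fst (prod_decode (f xs)))"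
proof -
  have "recursive_fn 1 (\<lambda>xs. LEAST a. \<exists>b < Suc (hd xs). prod_encode (a, b) = hd xs)"
  proof (rule recursive_fn_Least)
    show "recursive_rel (Suc 1)
      (\<lambda>ys. \<exists>b < Suc (hd (tl ys)). prod_encode (hd ys, b) = hd (tl ys))"
      by (intro recursive_rel_bex recursive_fn_Suc recursive_rel_eq recursive_fn_prod_encode
          recursive_fn_projections) auto
    show "\<exists>a. \<exists>b < Suc (hd xs). prod_encode (a, b) = hd xs" for xs
      by (metis le_imp_less_Suc le_prod_encode_2 prod_decode_inverse surj_pair)
  qed
  moreover have "(LEAST a. \<exists>b < Suc z. prod_encode (a, b) = z) = fst (prod_decode z)" for z
  proof (rule Least_equality)
    show "\<exists>b < Suc z. prod_encode (fst (prod_decode z), b) = z"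
      by (metis le_imp_less_Suc le_prod_encode_2 prod_decode_inverse prod.collapse)
  qed auto
  ultimately show ?thesis
    using recursive_fn_comp1[where g = "\<lambda>xs. fst (prod_decode (hd xs))", OF _ assms] by simp
qed

lemma recursive_fn_snd_prod_decode:
  assumes "recursive_fn n f"
  shows "recursive_fn n (\<lambda>xs. snd (prod_decode (f xs)))"
proof -
  have "recursive_fn 1 (\<lambda>xs. LEAST b. \<exists>a < Suc (hd xs). prod_encode (a, b) = hd xs)"
  proof (rule recursive_fn_Least)
    show "recursive_rel (Suc 1)
      (\<lambda>ys. \<exists>a < Suc (hd (tl ys)). prod_encode (a, hd ys) = hd (tl ys))"
      by (intro recursive_rel_bex recursive_fn_Suc recursive_rel_eq recursive_fn_prod_encode
          recursive_fn_projections) auto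
    show "\<exists>b. \<exists>a < Suc (hd xs). prod_encode (a, b) = hd xs" for xs
      by (metis le_imp_less_Suc le_prod_encode_1 prod_decode_inverse surj_pair)
  qed
  moreover have "(LEAST b. \<exists>a < Suc z. prod_encode (a, b) = z) = snd (prod_decode z)" for z
  proof (rule Least_equality)
    show "\<exists>a < Suc z. prod_encode (a, snd (prod_decode z)) = z"
      by (metis le_imp_less_Suc le_prod_encode_1 prod_decode_inverse prod.collapse)
  qed auto
  ultimately show ?thesis
    using recursive_fn_comp1[where g = "\<lambda>xs. snd (prod_decode (hd xs))", OF _ assms] by simp
qed

lemmas recursive_intros =
  recursive_fn_projections recursive_fn_Suc recursive_fn_prod_encode
  recursive_fn_fst_prod_decode recursive_fn_snd_prod_decode
  recursive_rel_le recursive_rel_less recursive_rel_eq recursive_rel_not recursive_rel_conj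
  recursive_rel_disj recursive_rel_imp recursive_rel_bex recursive_rel_ball

section \<open>Recursively enumerable sets as projections\<close>

text \<open>Stage \<open>s\<close> collects what an enumeration lists up to index \<open>s\<close>;
  making the stages cumulative is what allows limit arguments later.\<close>

lemma re_set_stages:
  assumes "re_set A"
  obtains T where "recursive_rel 2 T" and "\<And>p. p \<in> A \<longleftrightarrow> (\<exists>s. T [p, s])"
    and "\<And>p s t. T [p, s] \<Longrightarrow> s \<le> t \<Longrightarrow> T [p, t]"
proof (cases "A = {}")
  case True
  then show ?thesis
    using that[of "\<lambda>_. False"] recursive_rel_const by simp
next
  case False
  then obtain f where f: "recursive f" "A = range f"
    using assms unfolding re_set_def by blast
  show ?thesis
  proof (rule that[of "\<lambda>xs. \<exists>u < Suc (xs ! 1). f u = xs ! 0"])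
    show "recursive_rel 2 (\<lambda>xs. \<exists>u < Suc (xs ! 1). f u = xs ! 0)"
      by (intro recursive_intros recursive_fn_recursive[OF f(1)]) auto
  qed (use f(2) in \<open>auto simp: less_Suc_eq_le intro: order_trans\<close>)
qed

lemma re_set_projection:
  assumes "recursive_rel 2 Q"
  shows "re_set {p. \<exists>s. Q [p, s]}"
proof (cases "{p. \<exists>s. Q [p, s]} = {}")
  case True
  then show ?thesis
    unfolding re_set_def by simp
next
  case False
  then obtain p0 s0 where p0: "Q [p0, s0]"
    by auto
  \<comment> \<open>All coded pairs are run through. A pair that fails \<open>Q\<close> is sent to
    the known element \<open>p0\<close>, which keeps \<open>f\<close> total and its range inside the
    set.\<close>
  define f where "f m = (let (p, s) = prod_decode m in if Q [p, s] then p else p0)" for m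
  have "recursive f"
    unfolding recursive_def f_def Let_def case_prod_beta
    by (intro recursive_fn_if recursive_rel_comp2 recursive_intros recursive_fn_const assms) auto
  moreover have "f m \<in> {p. \<exists>s. Q [p, s]}" for m
    using p0 unfolding f_def by (auto split: prod.split)
  moreover have "p \<in> range f" if "Q [p, s]" for p s
    using that by (intro image_eqI[of _ _ "prod_encode (p, s)"]) (auto simp: f_def)
  ultimately show ?thesis
    unfolding re_set_def by blast
qed

section \<open>Finite extended teaching dimension means finite family\<close>

text \<open>Koenig's lemma on the binary tree: of the two one-bit extensions of a prefix shared by
  infinitely many members, at least one is again shared by infinitely many.\<close>

lemma infinite_family_accumulation_point:
  fixes F :: "nat set set"
  assumes "infinite F"
  obtains L where "\<And>n. infinite {L' \<in> F. L' \<inter> {..<n} = L \<inter> {..<n}}"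
proof -
  have step: "\<exists>D'. infinite {L' \<in> F. L' \<inter> {..<Suc n} = D'} \<and> D' \<inter> {..<n} = D"
    if inf: "infinite {L' \<in> F. L' \<inter> {..<n} = D}" for n D
  proof -
    let ?G = "\<lambda>D'. {L' \<in> F. L' \<inter> {..<Suc n} = D'}"
    have "{L' \<in> F. L' \<inter> {..<n} = D} \<subseteq> ?G D \<union> ?G (insert n D)"
      by (auto simp: lessThan_Suc)
    then have "infinite (?G D) \<or> infinite (?G (insert n D))"
      using inf finite_subset[OF _ finite_UnI] by blast
    \<comment> \<open>Such an \<open>L'\<close> only serves to show that \<open>D\<close> lies below
      \<open>n\<close>, so that both extensions restrict to \<open>D\<close>.\<close>
    moreover obtain L' where "L' \<inter> {..<n} = D"
      using infinite_imp_nonempty[OF inf] by blast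
    then have "D \<inter> {..<n} = D" "insert n D \<inter> {..<n} = D"
      by auto
    ultimately show ?thesis
      by blast
  qed
  let ?P = "\<lambda>n D. infinite {L' \<in> F. L' \<inter> {..<n} = D}"
  have "\<exists>c. \<forall>n. ?P n (c n) \<and> c (Suc n) \<inter> {..<n} = c n"
  proof (rule dependent_nat_choice)
    show "\<exists>D. ?P 0 D"
      using assms by (intro exI[of _ "{}"]) simp
  qed (rule step)
  then obtain c where c: "\<And>n. ?P n (c n)" and cSuc: "\<And>n. c (Suc n) \<inter> {..<n} = c n"
    by auto
  have c_mono: "c m \<inter> {..<n} = c n" if "n \<le> m" for m n
    using that
  proof (induction rule: dec_induct)
    case base
    show ?case
      using cSuc[of n] by blast
  next
    case (step m)
    then show ?case
      using cSuc[of m] by (metis inf.absorb_iff2 inf_assoc lessThan_subset_iff)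
  qed
  \<comment> \<open>The limit of the branch is its union: for \<open>m \<ge> n\<close> the part of
    \<open>c m\<close> below \<open>n\<close> is \<open>c n\<close>, and for smaller
    \<open>m\<close> the whole of \<open>c m\<close> is part of \<open>c n\<close>.\<close>
  have "(\<Union>m. c m) \<inter> {..<n} = c n" for n
  proof -
    have "c m \<inter> {..<n} \<subseteq> c n" for m
      by (cases "n \<le> m") (use c_mono[of n m] c_mono[of m n] in auto)
    then show ?thesis
      using cSuc[of n] by blast
  qed
  then show ?thesis
    using that[of "\<Union>m. c m"] c by simp
qed

text \<open>An accumulation point agrees with two members on any finite set. Conversely, points
  separating the pairs of a finite family specify every \<open>L\<close> at once.\<close>

lemma XTD_finite_iff: "XTD F < \<infinity> \<longleftrightarrow> finite F"
proof
  assume "XTD F < \<infinity>"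
  then obtain d where "\<forall>L. \<exists>S. finite S \<and> card S \<le> d \<and> specifying_set F L S"
    unfolding XTD_def Inf_less_iff by blast
  then have spec: "\<exists>S. finite S \<and> specifying_set F L S" for L
    by blast
  show "finite F"
  proof (rule ccontr)
    assume "infinite F"
    from infinite_family_accumulation_point[OF this]
    obtain L where L: "\<And>n. infinite {L' \<in> F. L' \<inter> {..<n} = L \<inter> {..<n}}"
      by metis
    obtain S where S: "finite S" "specifying_set F L S"
      using spec by blast
    obtain n where n: "S \<subseteq> {..<n}"
      using S(1)[unfolded finite_nat_iff_bounded] ..
    let ?G = "{L' \<in> F. L' \<inter> {..<n} = L \<inter> {..<n}}"
    have agree: "L' \<in> F \<and> L \<inter> S = L' \<inter> S" if "L' \<in> ?G" for L'
      using that n by auto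
    obtain A where A: "A \<in> ?G"
      using infinite_imp_nonempty[OF L[of n]] unfolding ex_in_conv[symmetric] ..
    obtain B where B: "B \<in> ?G - {A}"
      using infinite_imp_nonempty[OF infinite_remove[OF L[of n]]] unfolding ex_in_conv[symmetric] ..
    have "A = B"
      using S(2)[unfolded specifying_set_def] agree[OF A] agree[OF DiffD1[OF B]] by (rule Uniq_D)
    with B show False
      by simp
  qed
next
  assume fin: "finite F"
  \<comment> \<open>For \<open>A = B\<close> no separating point exists and the choice is arbitrary;
    one more point in \<open>D\<close> does no harm.\<close>
  define D where "D = (\<lambda>(A, B). SOME x. x \<in> A \<longleftrightarrow> x \<notin> B) ` (F \<times> F)"
  have "finite D"
    using fin unfolding D_def by simp
  have sep: "\<exists>x\<in>D. x \<in> A \<longleftrightarrow> x \<notin> B" if "A \<in> F" "B \<in> F" "A \<noteq> B" for A B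
  proof -
    have "\<exists>x. x \<in> A \<longleftrightarrow> x \<notin> B"
      using \<open>A \<noteq> B\<close> by auto
    then have "(SOME x. x \<in> A \<longleftrightarrow> x \<notin> B) \<in> A \<longleftrightarrow> (SOME x. x \<in> A \<longleftrightarrow> x \<notin> B) \<notin> B"
      by (rule someI_ex)
    moreover have "(SOME x. x \<in> A \<longleftrightarrow> x \<notin> B) \<in> D"
      using that unfolding D_def by (intro image_eqI[of _ _ "(A, B)"]) auto
    ultimately show ?thesis
      by blast
  qed
  have "specifying_set F L D" for L
    unfolding specifying_set_def
  proof (rule Uniq_I)
    fix A B
    assume *: "A \<in> F \<and> L \<inter> D = A \<inter> D" "B \<in> F \<and> L \<inter> D = B \<inter> D"
    then have "A \<inter> D = B \<inter> D"
      by simp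
    then show "B = A"
      using sep[of A B] * by auto
  qed
  then have "XTD F \<le> enat (card D)"
    unfolding XTD_def using \<open>finite D\<close> by (auto intro!: Inf_lower)
  then show "XTD F < \<infinity>"
    by (rule order_le_less_trans) simp
qed

text \<open>A finite family has finitely many failing inclusions, and \<open>n\<close> can be put
  above a witness of each. Conversely the test, applied in both directions, makes each member
  determined by its part below \<open>n\<close>.\<close>

lemma finite_range_iff_bounded_inclusion_test:
  fixes L :: "nat \<Rightarrow> nat set"
  shows "finite (range L) \<longleftrightarrow> (\<exists>n. \<forall>i j. L i \<inter> {..<n} \<subseteq> L j \<longrightarrow> L i \<subseteq> L j)"
proof
  assume fin: "finite (range L)"
  \<comment> \<open>The choice is arbitrary when \<open>A \<subseteq> B\<close>; only failing
    inclusions use it.\<close>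
  let ?w = "\<lambda>(A, B). SOME x. x \<in> A - B"
  have "finite (?w ` (range L \<times> range L))"
    using fin by simp
  then obtain n where n: "?w ` (range L \<times> range L) \<subseteq> {..<n}"
    unfolding finite_nat_iff_bounded ..
  have "L i \<subseteq> L j" if "L i \<inter> {..<n} \<subseteq> L j" for i j
  proof (rule ccontr)
    assume "\<not> L i \<subseteq> L j"
    then have "?w (L i, L j) \<in> L i - L j"
      using someI_ex[of "\<lambda>x. x \<in> L i - L j"] by auto
    moreover have "?w (L i, L j) \<in> {..<n}"
      using n by (rule subsetD) (rule imageI, simp)
    ultimately show False
      using that by blast
  qed
  then show "\<exists>n. \<forall>i j. L i \<inter> {..<n} \<subseteq> L j \<longrightarrow> L i \<subseteq> L j"
    by blast
next
  assume "\<exists>n. \<forall>i j. L i \<inter> {..<n} \<subseteq> L j \<longrightarrow> L i \<subseteq> L j"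
  then obtain n where n: "\<And>i j. L i \<inter> {..<n} \<subseteq> L j \<Longrightarrow> L i \<subseteq> L j"
    by auto
  have "inj_on (\<lambda>A. A \<inter> {..<n}) (range L)"
  proof (rule inj_onI, elim imageE, hypsubst)
    fix i j
    assume "L i \<inter> {..<n} = L j \<inter> {..<n}"
    then have "L i \<inter> {..<n} \<subseteq> L j" "L j \<inter> {..<n} \<subseteq> L i"
      by auto
    then show "L i = L j"
      by (intro subset_antisym n)
  qed
  moreover have "finite ((\<lambda>A. A \<inter> {..<n}) ` range L)"
    by (rule finite_subset[of _ "Pow {..<n}"]) auto
  ultimately show "finite (range L)"
    by (rule finite_imageD[rotated])
qed

section \<open>The upper bound\<close>

text \<open>
  The premise is a \<open>\<Delta>\<^sub>2\<close> condition and the conclusion a \<open>\<Pi>\<^sub>2\<close> condition. They can share the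
  quantifiers \<open>\<forall>s. \<exists>t \<ge> s\<close> because \<open>n\<close> is fixed: a true inclusion below \<open>n\<close> holds at all late
  stages, so a separating \<open>y < n\<close> at arbitrarily late stages shows that it fails in the limit.
\<close>
lemma bounded_inclusion_test_stages:
  fixes A B :: "nat \<Rightarrow> nat set"
  assumes "\<And>s t. s \<le> t \<Longrightarrow> A s \<subseteq> A t" and "\<And>s t. s \<le> t \<Longrightarrow> B s \<subseteq> B t"
  shows "((\<Union>s. A s) \<inter> {..<n} \<subseteq> (\<Union>s. B s) \<longrightarrow> (\<Union>s. A s) \<subseteq> (\<Union>s. B s)) \<longleftrightarrow>
    (\<forall>s x. \<exists>t y. s \<le> t \<and> (y < n \<and> y \<in> A t \<and> y \<notin> B t \<or> (x \<in> A s \<longrightarrow> x \<in> B t)))"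
    (is "?L \<longleftrightarrow> ?R")
proof
  assume L: ?L
  show ?R
  proof (intro allI)
    fix s x
    show "\<exists>t y. s \<le> t \<and> (y < n \<and> y \<in> A t \<and> y \<notin> B t \<or> (x \<in> A s \<longrightarrow> x \<in> B t))"
    proof (cases "(\<Union>s. A s) \<subseteq> (\<Union>s. B s)")
      case True
      then have "x \<in> A s \<longrightarrow> (\<exists>t. x \<in> B t)"
        by blast
      then have "\<exists>t\<ge>s. x \<in> A s \<longrightarrow> x \<in> B t"
        using assms(2) by (meson in_mono nle_le order_refl)
      then show ?thesis
        by blast
    next
      case False
      \<comment> \<open>When the inclusion fails, \<open>?L\<close> makes it fail already below
        \<open>n\<close>; a separating \<open>y\<close> is in \<open>A\<close> from some stage on
        and never in \<open>B\<close>.\<close>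
      then have "\<not> (\<Union>s. A s) \<inter> {..<n} \<subseteq> (\<Union>s. B s)"
        by (rule contrapos_nn) (rule L[THEN mp])
      then obtain y where y: "y < n" "y \<in> (\<Union>s. A s)" "y \<notin> (\<Union>s. B s)"
        unfolding subset_iff by auto
      then obtain r where "y \<in> A r"
        by auto
      then have "y \<in> A (max r s)"
        using assms(1)[of r "max r s"] by auto
      then show ?thesis
        using y by (intro exI[of _ "max r s"] exI[of _ y]) simp
    qed
  qed
next
  assume R: ?R
  show ?L
  proof (intro impI subsetI)
    fix x
    assume sub: "(\<Union>s. A s) \<inter> {..<n} \<subseteq> (\<Union>s. B s)" and "x \<in> (\<Union>s. A s)"
    then obtain r where r: "x \<in> A r"
      by blast
    \<comment> \<open>Only finitely many \<open>y < n\<close> matter, so those that ever enter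
      \<open>B\<close> have all entered by one stage. For \<open>n = 0\<close> the
      \<open>Max\<close> below is unspecified, but then nothing is asked of it.\<close>
    have "\<exists>s. \<forall>y<n. y \<in> (\<Union>s. B s) \<longrightarrow> y \<in> B s"
    proof -
      have "\<exists>s. y \<in> (\<Union>s. B s) \<longrightarrow> y \<in> B s" for y
        by blast
      then obtain u where u: "\<And>y. y \<in> (\<Union>s. B s) \<Longrightarrow> y \<in> B (u y)"
        by metis
      have "y \<in> B (Max (u ` {..<n}))" if "y < n" "y \<in> (\<Union>s. B s)" for y
        using assms(2)[of "u y" "Max (u ` {..<n})"] u[OF that(2)] that(1) by auto
      then show ?thesis
        by blast
    qed
    then obtain s where s: "\<And>y. y < n \<Longrightarrow> y \<in> (\<Union>s. B s) \<Longrightarrow> y \<in> B s"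
      by blast
    \<comment> \<open>From \<open>s\<close> on no \<open>y < n\<close> can separate, by
      \<open>sub\<close>; from \<open>r\<close> on \<open>x\<close> is in \<open>A\<close>. So the
      second disjunct must deliver \<open>x\<close>.\<close>
    obtain t y where ty: "max r s \<le> t"
      "y < n \<and> y \<in> A t \<and> y \<notin> B t \<or> (x \<in> A (max r s) \<longrightarrow> x \<in> B t)"
      using R by blast
    have "y \<in> B t" if "y < n" "y \<in> A t"
      using s[of y] sub that assms(2)[of s t] ty(1) by auto
    moreover have "x \<in> A (max r s)"
      using r assms(1)[of r "max r s"] by auto
    ultimately show "x \<in> (\<Union>s. B s)"
      using ty(2) by blast
  qed
qed

text \<open>Pairing contracts adjacent quantifiers of the same kind, so that each block takes up a
  single variable of the alternating prefix.\<close>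

lemma all_prod_decode: "(\<forall>u. P (fst (prod_decode u)) (snd (prod_decode u))) \<longleftrightarrow> (\<forall>a b. P a b)"
  by (metis fst_conv prod_encode_inverse snd_conv)

lemma ex_prod_decode: "(\<exists>u. P (fst (prod_decode u)) (snd (prod_decode u))) \<longleftrightarrow> (\<exists>a b. P a b)"
  by (metis fst_conv prod_encode_inverse snd_conv)

text \<open>Finiteness of the family, expressed through stages, has the shape
  \<open>\<exists>n. \<forall>i j s x. \<exists>t y\<close> over a recursive matrix.\<close>

lemma sigma_set_I_XTD:
  assumes "uniformly_re W"
  shows "sigma_set 3 (I_XTD W)"
proof -
  obtain T where T: "recursive_rel 2 T"
    and T_iff: "\<And>p. p \<in> {prod_encode (e, x) | e x. x \<in> W e} \<longleftrightarrow> (\<exists>s. T [p, s])"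
    and T_mono: "\<And>p s t. T [p, s] \<Longrightarrow> s \<le> t \<Longrightarrow> T [p, t]"
    by (rule re_set_stages[OF assms[unfolded uniformly_re_def]]) blast
  define K where "K e i s = {x. T [prod_encode (e, prod_encode (i, x)), s]}" for e i s
  have K_mono: "s \<le> t \<Longrightarrow> K e i s \<subseteq> K e i t" for e i s t
    unfolding K_def by (auto intro: T_mono)
  have lang: "lang W e i = (\<Union>s. K e i s)" for e i
    using T_iff[of "prod_encode (e, prod_encode (i, x))" for x]
    by (intro set_eqI) (simp add: lang_def K_def)
  define M where "M e n i j s x t y \<longleftrightarrow>
    s \<le> t \<and> (y < n \<and> y \<in> K e i t \<and> y \<notin> K e j t \<or> (x \<in> K e i s \<longrightarrow> x \<in> K e j t))"
    for e n i j s x t y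
  have test: "((\<Union>s. K e i s) \<inter> {..<n} \<subseteq> (\<Union>s. K e j s) \<longrightarrow> (\<Union>s. K e i s) \<subseteq> (\<Union>s. K e j s)) \<longleftrightarrow>
    (\<forall>s x. \<exists>t y. M e n i j s x t y)" for e n i j
    unfolding M_def by (rule bounded_inclusion_test_stages) (rule K_mono, assumption)+
  let ?l = "\<lambda>z. fst (prod_decode z)" and ?r = "\<lambda>z. snd (prod_decode z)"
  \<comment> \<open>Entries 0 and 1 are \<open>e\<close> and \<open>n\<close>, entry 2 codes
    \<open>(i, (j, (s, x)))\<close>, entry 3 codes \<open>(t, y)\<close>.\<close>
  define R where "R xs = M (xs ! 0) (xs ! 1) (?l (xs ! 2)) (?l (?r (xs ! 2)))
    (?l (?r (?r (xs ! 2)))) (?r (?r (?r (xs ! 2)))) (?l (xs ! 3)) (?r (xs ! 3))" for xs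
  have "recursive_rel 4 R"
    unfolding R_def M_def K_def mem_Collect_eq
    by (intro recursive_intros recursive_rel_comp2[OF T]) auto
  moreover have "e \<in> I_XTD W \<longleftrightarrow> sigma_prefix 3 R [e]" for e
  proof -
    have "e \<in> I_XTD W \<longleftrightarrow> (\<exists>n. \<forall>i j s x. \<exists>t y. M e n i j s x t y)"
      by (simp only: I_XTD_def lang_family_def XTD_finite_iff mem_Collect_eq
          finite_range_iff_bounded_inclusion_test lang test)
    also have "\<dots> \<longleftrightarrow> (\<exists>n. \<forall>u. \<exists>v. R [e, n, u, v])"
    proof -
      have "(\<exists>v. R [e, n, u, v]) \<longleftrightarrow> (\<exists>t y. M e n (?l u) (?l (?r u)) (?l (?r (?r u)))
        (?r (?r (?r u))) t y)" for n u
        using ex_prod_decode[of "M e n (?l u) (?l (?r u)) (?l (?r (?r u))) (?r (?r (?r u)))"]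
        by (simp add: R_def)
      \<comment> \<open>The universal block is unpacked from the outside inwards, one pairing per
        instance.\<close>
      then show ?thesis
        using all_prod_decode[of "\<lambda>i u. \<exists>t y. M e n i (?l u) (?l (?r u)) (?r (?r u)) t y" for n]
          all_prod_decode[of "\<lambda>j u. \<exists>t y. M e n i j (?l u) (?r u) t y" for n i]
          all_prod_decode[of "\<lambda>s x. \<exists>t y. M e n i j s x t y" for n i j]
        by simp
    qed
    also have "\<dots> \<longleftrightarrow> sigma_prefix 3 R [e]"
      by (simp add: numeral_3_eq_3)
    finally show ?thesis .
  qed
  ultimately show ?thesis
    unfolding sigma_set_def by (intro exI[of _ R]) auto
qed

section \<open>Hardness\<close>

text \<open>The part \<open>y < a\<close> makes the union of the family \<open>UNIV\<close> even if
  no \<open>a'\<close> is a witness. The bounds with \<open>Suc\<close> state \<open>\<le>\<close>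
  in the strict form that the closure rules for bounded quantifiers accept.\<close>

definition segment_family :: "(nat list \<Rightarrow> bool) \<Rightarrow> nat \<Rightarrow> nat \<Rightarrow> nat set" where
  "segment_family R x a = {y. y < a \<or> (\<exists>a' < Suc a. \<forall>b < Suc y. \<exists>c. R [x, a', b, c])}"

text \<open>From a witness \<open>a\<close> on every member is \<open>UNIV\<close>. Without a
  witness each member is finite, yet their union is \<open>UNIV\<close>, so there must be infinitely
  many.\<close>

lemma finite_range_segment_family:
  "finite (range (segment_family R x)) \<longleftrightarrow> (\<exists>a. \<forall>b. \<exists>c. R [x, a, b, c])"
proof
  assume "\<exists>a. \<forall>b. \<exists>c. R [x, a, b, c]"
  then obtain a where a: "\<And>b. \<exists>c. R [x, a, b, c]"
    by blast
  have univ: "segment_family R x a' = UNIV" if "a \<le> a'" for a'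
    using a that unfolding segment_family_def by (auto simp: less_Suc_eq_le)
  have "range (segment_family R x) \<subseteq> insert UNIV (segment_family R x ` {..<a})"
  proof (rule image_subsetI)
    show "segment_family R x a' \<in> insert UNIV (segment_family R x ` {..<a})" for a'
      by (cases "a \<le> a'") (simp_all add: univ)
  qed
  then show "finite (range (segment_family R x))"
    by (rule finite_subset) simp
next
  assume fin: "finite (range (segment_family R x))"
  show "\<exists>a. \<forall>b. \<exists>c. R [x, a, b, c]"
  proof (rule ccontr)
    assume "\<nexists>a. \<forall>b. \<exists>c. R [x, a, b, c]"
    \<comment> \<open>\<open>h a\<close> is a \<open>b\<close> at which \<open>a\<close> fails as a
      witness; hence \<open>a\<close> contributes only numbers below \<open>h a\<close>.\<close>
    then obtain h where h: "\<And>a c. \<not> R [x, a, h a, c]"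
      by metis
    have "finite (segment_family R x a)" for a
    proof -
      have "segment_family R x a \<subseteq> {..<a} \<union> (\<Union>a' < Suc a. {..<h a'})"
      proof
        fix y
        assume "y \<in> segment_family R x a"
        then consider "y < a" | a' where "a' < Suc a" "\<And>b. b < Suc y \<Longrightarrow> \<exists>c. R [x, a', b, c]"
          unfolding segment_family_def by auto
        then show "y \<in> {..<a} \<union> (\<Union>a' < Suc a. {..<h a'})"
        proof cases
          case 2
          then have "\<not> h a' < Suc y"
            using h by auto
          then show ?thesis
            using 2(1) by (intro UnI2 UN_I[of a']) auto
        qed simp
      qed
      then show ?thesis
        by (rule finite_subset) simp
    qed
    then have "finite (\<Union>(range (segment_family R x)))"
      by (intro finite_Union fin) auto
    moreover have "y \<in> segment_family R x (Suc y)" for y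
      unfolding segment_family_def by simp
    then have "\<Union>(range (segment_family R x)) = UNIV"
      by auto
    ultimately show False
      by simp
  qed
qed

text \<open>Finitely many \<open>b\<close> need only finitely many \<open>c\<close>, so one stage
  \<open>s\<close> bounds them all and the unbounded quantifier moves in front of the bounded ones,
  leaving a projection of a recursive relation.\<close>

lemma uniformly_re_segment_family:
  assumes R: "recursive_rel 4 R"
  shows "uniformly_re (\<lambda>x. {prod_encode (a, y) | a y. y \<in> segment_family R x a})"
proof -
  define Q where "Q x a y s \<longleftrightarrow>
    y < a \<or> (\<exists>a' < Suc a. \<forall>b < Suc y. \<exists>c < Suc s. R [x, a', b, c])" for x a y s
  have seg: "y \<in> segment_family R x a \<longleftrightarrow> (\<exists>s. Q x a y s)" for x a y
  proof -
    have "\<exists>s. \<forall>b < Suc y. \<exists>c < Suc s. R [x, a', b, c]" if "\<forall>b < Suc y. \<exists>c. R [x, a', b, c]" for a'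
    proof -
      from that have "\<forall>b. \<exists>c. b < Suc y \<longrightarrow> R [x, a', b, c]"
        by blast
      then obtain c where c: "\<And>b. b < Suc y \<Longrightarrow> R [x, a', b, c b]"
        by metis
      have "c b < Suc (Max (c ` {..<Suc y}))" if "b < Suc y" for b
        using that by (intro le_imp_less_Suc Max_ge) auto
      with c show ?thesis
        by (intro exI[of _ "Max (c ` {..<Suc y})"]) auto
    qed
    then show ?thesis
      unfolding segment_family_def Q_def mem_Collect_eq by blast
  qed
  let ?l = "\<lambda>z. fst (prod_decode z)" and ?r = "\<lambda>z. snd (prod_decode z)"
  \<comment> \<open>Entry 0 codes \<open>(x, (a, y))\<close>, entry 1 is the stage.\<close>
  define Q' where "Q' xs = Q (?l (xs ! 0)) (?l (?r (xs ! 0))) (?r (?r (xs ! 0))) (xs ! 1)" for xs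
  have "recursive_rel 2 Q'"
    unfolding Q'_def Q_def by (intro recursive_intros recursive_rel_comp4[OF R]) auto
  moreover have "{prod_encode (x, z) | x z. z \<in> {prod_encode (a, y) | a y. y \<in> segment_family R x a}}
    = {p. \<exists>s. Q' [p, s]}" (is "?A = ?B")
  proof (rule set_eqI)
    fix p
    obtain x a y where "p = prod_encode (x, prod_encode (a, y))"
      by (metis prod_decode_inverse surj_pair)
    then show "p \<in> ?A \<longleftrightarrow> p \<in> ?B"
      by (simp add: Q'_def seg)
  qed
  ultimately show ?thesis
    unfolding uniformly_re_def using re_set_projection by simp
qed

text \<open>The segment families are uniformly r.e. in \<open>x\<close>, so acceptability supplies a
  recursive \<open>f\<close> with \<open>f x\<close> an index of the family attached to
  \<open>x\<close>; finiteness of that family is equivalent to \<open>x \<in> B\<close>.\<close>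

lemma many_one_reducible_I_XTD:
  assumes W: "acceptable_numbering W" and B: "sigma_set 3 B"
  shows "many_one_reducible B (I_XTD W)"
proof -
  obtain R where R: "recursive_rel 4 R" and B_eq: "B = {x. sigma_prefix 3 R [x]}"
    using B unfolding sigma_set_def by (elim exE conjE) simp
  have B_iff: "x \<in> B \<longleftrightarrow> (\<exists>a. \<forall>b. \<exists>c. R [x, a, b, c])" for x
    unfolding B_eq by (simp add: numeral_3_eq_3)
  obtain f where f: "recursive f"
    and Wf: "\<And>x. {prod_encode (a, y) | a y. y \<in> segment_family R x a} = W (f x)"
    using W[unfolded acceptable_numbering_def, THEN conjunct2, THEN conjunct2, rule_format,
        OF uniformly_re_segment_family[OF R]] by auto
  have "lang W (f x) = segment_family R x" for x
    unfolding lang_def Wf[symmetric] by auto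
  then have "x \<in> B \<longleftrightarrow> f x \<in> I_XTD W" for x
    unfolding I_XTD_def lang_family_def
    by (simp add: XTD_finite_iff finite_range_segment_family B_iff del: enat_ord_simps)
  then show ?thesis
    unfolding many_one_reducible_def by (intro exI[of _ f] conjI f allI)
qed

theorem theorem7:
  fixes W :: "nat \<Rightarrow> nat set"
  assumes "acceptable_numbering W"
  shows "sigma_complete 3 (I_XTD W)"
  unfolding sigma_complete_def
  using sigma_set_I_XTD many_one_reducible_I_XTD[OF assms] assms[unfolded acceptable_numbering_def]
  by simp

end
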